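(* Let $P_0,Q$ be two probability laws on the same measurable space, let $n\ge 1$ be an integer, and let $P_n=P_0^{\otimes n}$ and $Q_n=Q^{\otimes n}$ be the $n$-fold product laws. Then $$\inf_{0\le\phi\le 1}\{\mathbb E_{P_n}\phi+\mathbb E_{Q_n}(1-\phi)\}=1-\operatorname{TV}(P_n,Q_n),$$ where the infimum ranges over all measurable functions $\phi$ on the product space with values in $[0,1]$ (randomized rejection rules).
   Context: For probability measures $P,Q$ on a common measurable space, $\operatorname{TV}(P,Q)=\sup_B|P(B)-Q(B)|$, the supremum being over measurable sets $B$. *)

theory Defs
  imports "HOL-Probability.Probability"
begin

text \<open>
  Meant for probability measures with \<open>sets P = sets Q\<close>.  The supremum is then over a
  nonempty set of reals bounded by 1, so \<open>Sup\<close> on type \<open>real\<close> is the genuine supremum.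
\<close>
definition tv_dist :: "'a measure \<Rightarrow> 'a measure \<Rightarrow> real" where
  "tv_dist P Q = (SUP B\<in>sets P. \<bar>measure P B - measure Q B\<bar>)"

text \<open>
  The index set \<open>{..<n}\<close> plays the role of the \<open>n\<close> factors; the points of the product space are
  the functions on \<open>{..<n}\<close> (extended by \<open>undefined\<close> outside) with values in \<open>space P\<close>.
\<close>
definition iid_law :: "nat \<Rightarrow> 'a measure \<Rightarrow> (nat \<Rightarrow> 'a) measure" where
  "iid_law n P = PiM {..<n} (\<lambda>_. P)"

text \<open>Depends on \<open>M\<close> only through its underlying measurable space.\<close>
definition randomized_rules :: "'a measure \<Rightarrow> ('a \<Rightarrow> real) set" where
  "randomized_rules M = {\<phi> \<in> borel_measurable M. \<forall>x\<in>space M. 0 \<le> \<phi> x \<and> \<phi> x \<le> 1}"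

end

theory Submission
  imports Defs
begin

text \<open>
  Rounding a rule \<open>\<phi>\<close> down to a multiple of \<open>1/k\<close> gives the average of the indicators of the
  \<open>k\<close> superlevel sets \<open>{\<phi> \<ge> j/k}\<close>, so the difference of the expectations of \<open>\<phi>\<close> under two laws
  is at most the average of \<open>k\<close> differences of probabilities of events, up to \<open>1/k\<close>.  Letting
  \<open>k \<rightarrow> \<infinity>\<close> shows that no rule beats the total variation bound; indicators of events attain it
  up to an arbitrarily small error.  The product structure plays no role.
\<close>

text \<open>The indices that count run from 1 to the floor of \<open>y\<close>, and
  \<open>y \<le> real k\<close> ensures that the sum reaches that far.\<close>

lemma sum_indicator_eq_floor:
  fixes y :: real
  assumes "0 \<le> y" "y \<le> real k"
  shows "(\<Sum>j=1..k. if real j \<le> y then 1 else 0) = of_int \<lfloor>y\<rfloor>"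
proof -
  have "{j \<in> {1..k}. real j \<le> y} = {1..nat \<lfloor>y\<rfloor>}"
    using assms by (auto simp: le_nat_floor le_floor_iff) linarith+
  then show ?thesis
    using assms by (simp add: sum.If_cases Int_def)
qed

text \<open>Multiplying by \<open>k\<close> turns \<open>r\<close> into the floor of
  \<open>k * y\<close>, so both claims are the usual bounds on a floor.\<close>

lemma rule_le_average_superlevel:
  fixes y :: real
  assumes "0 \<le> y" "y \<le> 1" "0 < k"
  defines "r \<equiv> (\<Sum>j=1..k. if real j / real k \<le> y then 1 else 0) / real k"
  shows "r \<le> y" and "y \<le> r + 1 / real k"
proof -
  have "(\<Sum>j=1..k. if real j / real k \<le> y then 1 else 0) =
      (\<Sum>j=1..k. if real j \<le> real k * y then 1 else (0::real))"
    using assms by (intro sum.cong) (auto simp: field_simps)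
  also have "\<dots> = of_int \<lfloor>real k * y\<rfloor>"
    using assms by (intro sum_indicator_eq_floor) (auto simp: mult_left_le)
  finally have r: "r * real k = of_int \<lfloor>real k * y\<rfloor>"
    using assms by simp
  have "r * real k \<le> y * real k" "y * real k \<le> (r + 1 / real k) * real k"
    using assms(3) by (auto simp: r distrib_right mult.commute[of y])
  then show "r \<le> y" "y \<le> r + 1 / real k"
    using assms(3) by (simp_all only: mult_le_cancel_right_pos of_nat_0_less_iff)
qed

text \<open>Probabilities lie between 0 and 1, which bounds the family; on the reals an element is
  known to lie below the supremum only once such a bound is given.\<close>

lemma
  assumes "prob_space M" "prob_space N" "sets N = sets M"
  shows bdd_above_tv_dist: "bdd_above ((\<lambda>B. \<bar>measure M B - measure N B\<bar>) ` sets M)"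
    and abs_measure_diff_le_tv_dist: "B \<in> sets M \<Longrightarrow> \<bar>measure M B - measure N B\<bar> \<le> tv_dist M N"
proof -
  interpret M: prob_space M by fact
  interpret N: prob_space N by fact
  have "\<bar>measure M B - measure N B\<bar> \<le> 1" for B
    using M.prob_le_1[of B] N.prob_le_1[of B] measure_nonneg[of M B] measure_nonneg[of N B]
    by linarith
  then show *: "bdd_above ((\<lambda>B. \<bar>measure M B - measure N B\<bar>) ` sets M)"
    by (intro bdd_aboveI2[where M = 1])
  show "\<bar>measure M B - measure N B\<bar> \<le> tv_dist M N" if "B \<in> sets M"
    unfolding tv_dist_def using that * by (rule cSUP_upper)
qed

text \<open>Integrates the pointwise rounding bounds; each indicator contributes the probability of
  its superlevel set.\<close>

lemma integral_average_superlevel: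
  fixes \<phi> :: "'a \<Rightarrow> real"
  assumes "prob_space M" "\<phi> \<in> borel_measurable M" "\<forall>x\<in>space M. 0 \<le> \<phi> x \<and> \<phi> x \<le> 1" "0 < k"
  defines "r \<equiv> (\<Sum>j=1..k. measure M {x \<in> space M. real j / real k \<le> \<phi> x}) / real k"
  shows "integrable M \<phi>" and "r \<le> (\<integral>x. \<phi> x \<partial>M)" and "(\<integral>x. \<phi> x \<partial>M) \<le> r + 1 / real k"
proof -
  interpret prob_space M by fact
  note [measurable] = assms(2)
  \<comment> \<open>Indicators replace the conditionals so that \<open>g\<close> integrates termwise
    to \<open>r\<close>; \<open>g_eq\<close> recovers the pointwise form on
    \<open>space M\<close>.\<close>
  define g where "g x = (\<Sum>j=1..k. indicator {x \<in> space M. real j / real k \<le> \<phi> x} x) / real k" for x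
  have g_eq: "g x = (\<Sum>j=1..k. if real j / real k \<le> \<phi> x then 1 else 0) / real k"
    if "x \<in> space M" for x
    using that unfolding g_def by (intro arg_cong2[where f = "(/)"] sum.cong) (auto simp: indicator_def)
  have g: "g x \<le> \<phi> x" "\<phi> x \<le> g x + 1 / real k" if "x \<in> space M" for x
    unfolding g_eq[OF that] using assms(3,4) that by (blast intro: rule_le_average_superlevel)+
  show int: "integrable M \<phi>"
    using assms(3) by (intro integrable_const_bound[where B = 1]) auto
  have int_g: "integrable M g"
    unfolding g_def by (intro integrable_divide Bochner_Integration.integrable_sum
      integrable_real_indicator) (auto simp: emeasure_eq_measure)
  have "(\<integral>x. g x \<partial>M) = r"
    unfolding g_def r_def
    by (simp add: Bochner_Integration.integral_sum integrable_real_indicator emeasure_eq_measure Int_def conj_commute conj_left_commute cong: conj_cong)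
  moreover have "(\<integral>x. g x \<partial>M) \<le> (\<integral>x. \<phi> x \<partial>M)"
    using g by (intro integral_mono int int_g) auto
  moreover have "(\<integral>x. \<phi> x \<partial>M) \<le> (\<integral>x. g x + 1 / real k \<partial>M)"
    using g by (intro integral_mono int Bochner_Integration.integrable_add int_g) auto
  moreover have "(\<integral>x. g x + 1 / real k \<partial>M) = (\<integral>x. g x \<partial>M) + 1 / real k"
    using int_g by (simp add: prob_space)
  ultimately show "r \<le> (\<integral>x. \<phi> x \<partial>M)" "(\<integral>x. \<phi> x \<partial>M) \<le> r + 1 / real k"
    by simp_all
qed

text \<open>Both laws see the same superlevel sets, so the two averages can be compared level by
  level.\<close>

lemma integral_diff_le_tv_dist:
  fixes \<phi> :: "'a \<Rightarrow> real"
  assumes "prob_space M" "prob_space N" "sets N = sets M" "\<phi> \<in> randomized_rules M"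
  shows "(\<integral>x. \<phi> x \<partial>N) - (\<integral>x. \<phi> x \<partial>M) \<le> tv_dist M N"
proof -
  have [measurable]: "\<phi> \<in> borel_measurable M" "\<phi> \<in> borel_measurable N"
    and \<phi>: "\<forall>x\<in>space M. 0 \<le> \<phi> x \<and> \<phi> x \<le> 1"
    using assms(4) by (auto simp: randomized_rules_def measurable_cong_sets[OF assms(3)])
  have space: "space N = space M"
    using assms(3) by (rule sets_eq_imp_space_eq)
  \<comment> \<open>\<open>Suc i\<close> keeps the number of levels positive and matches the form
    that \<open>nat_approx_posE\<close> delivers.\<close>
  have bound: "(\<integral>x. \<phi> x \<partial>N) - (\<integral>x. \<phi> x \<partial>M) \<le> tv_dist M N + 1 / real (Suc i)" for i
  proof -
    define k where "k = Suc i"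
    define B where "B j = {x \<in> space M. real j / real k \<le> \<phi> x}" for j :: nat
    have [measurable]: "B j \<in> sets M" for j
      unfolding B_def by measurable
    have "measure N (B j) - measure M (B j) \<le> tv_dist M N" for j
      using abs_measure_diff_le_tv_dist[OF assms(1-3), of "B j"] by simp
    then have "(\<Sum>j=1..k. measure N (B j) - measure M (B j)) \<le> (\<Sum>j=1..k. tv_dist M N)"
      by (intro sum_mono)
    then have "(\<Sum>j=1..k. measure N (B j)) / real k - (\<Sum>j=1..k. measure M (B j)) / real k
        \<le> tv_dist M N"
      by (simp add: sum_subtractf k_def divide_simps mult.commute)
    \<comment> \<open>Under \<open>M\<close> rounding down goes in the wanted direction; only the
      expectation under \<open>N\<close> costs the error \<open>1 / k\<close>.\<close>
    moreover have "(\<Sum>j=1..k. measure M (B j)) / real k \<le> (\<integral>x. \<phi> x \<partial>M)"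
      unfolding B_def using assms(1) \<phi> by (intro integral_average_superlevel) (simp_all add: k_def)
    moreover have "(\<integral>x. \<phi> x \<partial>N) \<le> (\<Sum>j=1..k. measure N (B j)) / real k + 1 / real k"
      unfolding B_def space[symmetric] using assms(2) \<phi> space
      by (intro integral_average_superlevel) (auto simp: k_def)
    ultimately show ?thesis
      unfolding k_def by linarith
  qed
  show ?thesis
  proof (rule field_le_epsilon)
    fix e :: real assume "0 < e"
    then obtain i where "1 / real (Suc i) < e"
      using nat_approx_posE by blast
    then show "(\<integral>x. \<phi> x \<partial>N) - (\<integral>x. \<phi> x \<partial>M) \<le> tv_dist M N + e"
      using bound[of i] by linarith
  qed
qed

theorem INF_randomized_rules_eq_one_minus_tv_dist:
  fixes M N :: "'a measure"
  assumes "prob_space M" "prob_space N" "sets N = sets M"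
  shows "(INF \<phi>\<in>randomized_rules M. (\<integral>x. \<phi> x \<partial>M) + (\<integral>x. 1 - \<phi> x \<partial>N)) = 1 - tv_dist M N"
    (is "(INF \<phi>\<in>?R. ?risk \<phi>) = _")
proof (rule antisym)
  interpret M: prob_space M by fact
  interpret N: prob_space N by fact
  have space: "space N = space M"
    using assms(3) by (rule sets_eq_imp_space_eq)
  have risk: "?risk \<phi> = 1 - ((\<integral>x. \<phi> x \<partial>N) - (\<integral>x. \<phi> x \<partial>M))" if "\<phi> \<in> ?R" for \<phi>
  proof -
    \<comment> \<open>Needed to split the integral of \<open>1 - \<phi>\<close>. The number of
      levels is absent from this conclusion, so any positive one will do.\<close>
    have "integrable N \<phi>"
      using that space assms(3) zero_less_one
      by (intro integral_average_superlevel(1)[OF assms(2)])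
         (auto simp: randomized_rules_def measurable_cong_sets[OF assms(3)])
    then show ?thesis
      by (simp add: N.prob_space)
  qed
  have lower: "1 - tv_dist M N \<le> ?risk \<phi>" if "\<phi> \<in> ?R" for \<phi>
    using integral_diff_le_tv_dist[OF assms that] risk[OF that] by linarith
  have indicator_rule: "(indicator B :: 'a \<Rightarrow> real) \<in> ?R" if "B \<in> sets M" for B
    using that by (auto simp: randomized_rules_def)
  \<comment> \<open>The rule that never rejects shows that the infimum is over a nonempty set, as
    \<open>cINF_greatest\<close> requires.\<close>
  have "(\<lambda>_. 0) \<in> ?R"
    by (simp add: randomized_rules_def)
  then show "1 - tv_dist M N \<le> (INF \<phi>\<in>?R. ?risk \<phi>)"
    using lower by (intro cINF_greatest) auto
  have inf_le: "(INF \<phi>\<in>?R. ?risk \<phi>) \<le> 1 - (measure N B - measure M B)" if B: "B \<in> sets M" for B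
  proof -
    \<comment> \<open>Here \<open>lower\<close> supplies the bound from below without which an
      infimum of reals need not lie below its elements.\<close>
    have "(INF \<phi>\<in>?R. ?risk \<phi>) \<le> ?risk (indicator B)"
      using lower indicator_rule[OF B] by (intro cINF_lower bdd_belowI2) auto
    also have "\<dots> = 1 - (measure N B - measure M B)"
      using B sets.sets_into_space[OF B] unfolding risk[OF indicator_rule[OF B]]
      by (simp add: space Int_absorb2)
    finally show ?thesis .
  qed
  have "\<bar>measure M B - measure N B\<bar> \<le> 1 - (INF \<phi>\<in>?R. ?risk \<phi>)" if B: "B \<in> sets M" for B
  proof -
    \<comment> \<open>Passing to the complement flips the sign of the difference, so
      \<open>inf_le\<close> for \<open>B\<close> and for its complement together control the
      absolute value.\<close>
    have "measure M (space M - B) = 1 - measure M B" "measure N (space M - B) = 1 - measure N B"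
      using B M.prob_compl[of B] N.prob_compl[of B] by (simp_all add: space assms(3))
    then show ?thesis
      using inf_le[OF B] inf_le[of "space M - B"] B by (auto simp: abs_le_iff)
  qed
  then have "tv_dist M N \<le> 1 - (INF \<phi>\<in>?R. ?risk \<phi>)"
    unfolding tv_dist_def by (intro cSUP_least) auto
  then show "(INF \<phi>\<in>?R. ?risk \<phi>) \<le> 1 - tv_dist M N"
    by simp
qed

theorem theorem6p1:
  fixes P0 Q :: "'a measure" and n :: nat
  assumes "prob_space P0" and "prob_space Q" and "sets Q = sets P0" and "n \<ge> 1"
  shows "(INF \<phi>\<in>randomized_rules (iid_law n P0).
            (\<integral>x. \<phi> x \<partial>iid_law n P0) + (\<integral>x. 1 - \<phi> x \<partial>iid_law n Q))
         = 1 - tv_dist (iid_law n P0) (iid_law n Q)"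
  \<comment> \<open>Products of probability laws are probability laws, and the product sigma-algebra
    depends only on those of the factors.\<close>
  unfolding iid_law_def using assms(1-3)
  by (intro INF_randomized_rules_eq_one_minus_tv_dist prob_space_PiM sets_PiM_cong) auto

end
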